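(* If $\mathcal{H}\supseteq\{H : H\text{ is the edge set of a star subgraph},\ |H|\ge 2\}$, then $\kappa(\mathcal{H})\in\Omega(2^{|E|})$.
   Context: A set of edges is the edge set of a star subgraph if all its edges share a common endpoint (the center). For a simple, loop-free graph $G=(V,E)$ and $\mathcal{H}\subseteq 2^{E}$, let $B'(G,\mathcal{H})$ be the matrix with columns indexed by $E$ whose rows are the characteristic vectors (in $\{0,1\}^E$) of the sets $H\in\mathcal{H}$, and let $B=B(G,\mathcal{H})=\begin{bmatrix}B'(G,\mathcal{H})\\ I\end{bmatrix}$, where $I$ is the $|E|\times|E|$ identity matrix. For a real matrix $B$ with $n$ columns, the set of circuits $\mathcal{C}(0,B)$ consists of the vectors $g\in\mathbb{R}^n\setminus\{0\}$, normalized to coprime integer components, for which $Bg$ is support-minimal over $\{Bx : x\in\mathbb{R}^n\setminus\{0\}\}$. The circuit imbalance measure is $\kappa(0,B)=\max\{|g(i)/g(j)| : g\in\mathcal{C}(0,B),\ g(j)\neq0\}$, and $\kappa(\mathcal{H})=\max_G\kappa(0,B(G,\mathcal{H}))$. Here $\mathcal{H}$ is understood as a family of edge sets specified for every graph $G$ (so the inclusion in the hypothesis, with star subgraphs of $G$, holds for every $G$), and $\kappa(\mathcal{H})$ is regarded as a function of the number $|E|$ of edges, the maximum being taken over graphs with that number of edges. For $f,g:\mathbb{Z}^+\to\mathbb{R}^+$, $f(n)\in\Omega(g(n))$ means that there exist a real constant $c>0$ and an integer constant $n_0\ge1$ such that $f(n)\ge c\cdot g(n)$ for every integer $n\ge n_0$.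 *)

theory Defs
  imports Complex_Main "HOL-Library.Landau_Symbols" "HOL-Library.Indicator_Function"
begin

text \<open>
  A real matrix is given by a finite set \<open>R\<close> of row indices, a finite set \<open>C\<close> of column indices
  and an entry function \<open>B\<close>, of which only the values \<open>B r c\<close> with \<open>r \<in> R\<close>, \<open>c \<in> C\<close> are used.
  Vectors in \<open>\<real>\<^sup>C\<close> are functions that vanish outside \<open>C\<close>.
\<close>

definition vecs :: "'c set \<Rightarrow> ('c \<Rightarrow> real) set" where
  "vecs C = {x. \<forall>j. j \<notin> C \<longrightarrow> x j = 0}"

definition nonzero_vecs :: "'c set \<Rightarrow> ('c \<Rightarrow> real) set" where
  "nonzero_vecs C = vecs C - {\<lambda>_. 0}"

definition mult_vec :: "'c set \<Rightarrow> ('r \<Rightarrow> 'c \<Rightarrow> real) \<Rightarrow> ('c \<Rightarrow> real) \<Rightarrow> 'r \<Rightarrow> real" where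
  "mult_vec C B x = (\<lambda>r. \<Sum>j\<in>C. B r j * x j)"

definition supp :: "'r set \<Rightarrow> ('r \<Rightarrow> real) \<Rightarrow> 'r set" where
  "supp R y = {r \<in> R. y r \<noteq> 0}"

definition coprime_integral :: "'c set \<Rightarrow> ('c \<Rightarrow> real) \<Rightarrow> bool" where
  "coprime_integral C g \<longleftrightarrow> (\<exists>z :: 'c \<Rightarrow> int. (\<forall>j\<in>C. g j = of_int (z j)) \<and> Gcd (z ` C) = 1)"

definition circuits :: "'r set \<Rightarrow> 'c set \<Rightarrow> ('r \<Rightarrow> 'c \<Rightarrow> real) \<Rightarrow> ('c \<Rightarrow> real) set" where
  "circuits R C B = {g \<in> nonzero_vecs C. coprime_integral C g \<and>
     \<not> (\<exists>x \<in> nonzero_vecs C. supp R (mult_vec C B x) \<subset> supp R (mult_vec C B g))}"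

definition circuit_imbalance :: "'r set \<Rightarrow> 'c set \<Rightarrow> ('r \<Rightarrow> 'c \<Rightarrow> real) \<Rightarrow> real" where
  "circuit_imbalance R C B =
     Max {\<bar>g i / g j\<bar> | g i j. g \<in> circuits R C B \<and> i \<in> C \<and> j \<in> C \<and> g j \<noteq> 0}"

type_synonym 'v graph = "'v set \<times> 'v set set"

definition simple_graph :: "'v graph \<Rightarrow> bool" where
  "simple_graph G \<longleftrightarrow> finite (fst G) \<and> (\<forall>e \<in> snd G. e \<subseteq> fst G \<and> card e = 2)"

definition star_edge_sets :: "'v graph \<Rightarrow> 'v set set set" where
  "star_edge_sets G = {H. H \<subseteq> snd G \<and> (\<exists>v \<in> fst G. \<forall>e \<in> H. v \<in> e)}"

text \<open>
  The rows of the block matrix \<open>B(G, \<H>)\<close> are indexed by the disjoint sum \<open>\<H> <+> E\<close>: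
  \<open>Inl H\<close> is the row of the upper block belonging to \<open>H \<in> \<H>\<close>, and \<open>Inr e\<close> is the row of the
  identity block belonging to \<open>e \<in> E\<close>.
\<close>

definition stacked_matrix :: "'e set + 'e \<Rightarrow> 'e \<Rightarrow> real" where
  "stacked_matrix r e = (case r of Inl H \<Rightarrow> indicator H e | Inr d \<Rightarrow> (if d = e then 1 else 0))"

definition graph_imbalance :: "'v graph \<Rightarrow> 'v set set set \<Rightarrow> real" where
  "graph_imbalance G \<H> = circuit_imbalance (\<H> <+> snd G) (snd G) stacked_matrix"

text \<open>
  The family assigns a set of edge sets to every graph. For a family with \<open>\<H> G \<subseteq> Pow E\<close>, only
  finitely many matrices occur for each number \<open>m\<close> of edges up to renaming of columns, so the
  maximum ranges over a finite set of values although there are infinitely many graphs.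
\<close>

definition family_imbalance :: "('v graph \<Rightarrow> 'v set set set) \<Rightarrow> nat \<Rightarrow> real" where
  "family_imbalance \<H> m =
     Max {graph_imbalance G (\<H> G) | G. simple_graph G \<and> card (snd G) = m}"

end

theory Submission
  imports Defs
begin

text \<open>
  The witnesses are the stars themselves. In a star with \<open>m\<close> edges every set of edges is the edge set
  of a star subgraph, so, together with the identity block, the matrix has a row for every nonempty
  subset of its \<open>m\<close> columns. A vector \<open>g\<close> is then a circuit as soon as it is determined up to a
  factor by the subsets over which it sums to zero (\<open>zero_sum_rigid\<close>), and this stays true whatever
  further rows the family contributes: more rows only make it harder for another vector to have a
  smaller support (\<open>zero_sum_rigid_circuit\<close>). The task is to find such a \<open>g\<close> that has an entry \<open>1\<close> and an
  entry of size at least a constant times \<open>2 ^ m\<close>.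
  
  If each new entry is forced to be minus a subset sum of the earlier ones, the growth per column is
  at most the golden ratio. Better rates need several new columns that are coupled by a matrix with a
  large inverse. Here twelve columns are added at a time: given a subset of the old columns with sum
  \<open>q\<close>, subset equations force the new entries to be \<open>q\<close> times fixed integers, of which six sum to
  \<open>- 6378\<close> (\<open>amplifier_weights\<close>). As \<open>6378 > 2 ^ 12\<close>, iterating this beats the rate \<open>2\<close> per column
  (\<open>zero_sum_rigid_blocks\<close>). The coupling matrix is cut out of a circulant matrix on \<open>\<int>/13\<close>.
  Since circulant matrices commute, its inverse is circulant too and can be read off from a single
  integer vector.
  
  The maxima in the definitions bound their members only if they range over finite sets. The ratios
  of a circuit depend only on the support of its image, which gives \<open>finite_circuit_ratios\<close>; and the
  imbalance of a graph with \<open>m\<close> edges depends only on a set system on \<open>{..<m}\<close> after the edges have been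
  renamed, which gives \<open>finite_graph_imbalances\<close>.
\<close>

section \<open>Finiteness of the ratios of a matrix\<close>

definition circuit_ratios :: "'r set \<Rightarrow> 'c set \<Rightarrow> ('r \<Rightarrow> 'c \<Rightarrow> real) \<Rightarrow> real set" where
  "circuit_ratios R C B =
     {\<bar>g i / g j\<bar> | g i j. g \<in> circuits R C B \<and> i \<in> C \<and> j \<in> C \<and> g j \<noteq> 0}"

lemma mult_vec_combination:
  "mult_vec C B (\<lambda>j. a * x j - b * y j) r = a * mult_vec C B x r - b * mult_vec C B y r"
  unfolding mult_vec_def sum_distrib_left sum_subtractf[symmetric]
  by (intro sum.cong) (auto simp: algebra_simps)

text \<open>
  Two circuits \<open>g\<close>, \<open>h\<close> with the same image support have a nontrivial combination whose image also
  vanishes at a chosen point of that support. By minimality this combination is zero.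
\<close>

lemma circuits_same_support_proportional:
  assumes g: "g \<in> circuits R C B" and h: "h \<in> circuits R C B"
    and same: "supp R (mult_vec C B g) = supp R (mult_vec C B h)"
    and inj: "\<And>x. x \<in> nonzero_vecs C \<Longrightarrow> supp R (mult_vec C B x) \<noteq> {}"
  shows "\<exists>c. c \<noteq> 0 \<and> (\<forall>j. h j = c * g j)"
proof -
  have gnz: "g \<in> nonzero_vecs C" and hnz: "h \<in> nonzero_vecs C"
    using g h by (auto simp: circuits_def)
  obtain r where r: "r \<in> supp R (mult_vec C B g)"
    using inj[OF gnz] by blast
  define a b where "a = mult_vec C B h r" and "b = mult_vec C B g r"
  have a0: "a \<noteq> 0" and b0: "b \<noteq> 0"
    using r same by (auto simp: supp_def a_def b_def)
  define x where "x = (\<lambda>j. a * g j - b * h j)"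
  have Bx: "mult_vec C B x q = a * mult_vec C B g q - b * mult_vec C B h q" for q
    unfolding x_def by (rule mult_vec_combination)
  have "supp R (mult_vec C B x) \<subseteq> supp R (mult_vec C B g)"
  proof
    fix q assume q: "q \<in> supp R (mult_vec C B x)"
    show "q \<in> supp R (mult_vec C B g)"
    proof (rule ccontr)
      assume "q \<notin> supp R (mult_vec C B g)"
      moreover from this same have "q \<notin> supp R (mult_vec C B h)" by simp
      ultimately show False using q by (auto simp: supp_def Bx)
    qed
  qed
  moreover have "r \<notin> supp R (mult_vec C B x)"
    by (simp add: supp_def Bx a_def b_def)
  ultimately have "supp R (mult_vec C B x) \<subset> supp R (mult_vec C B g)"
    using r by blast
  then have "x \<notin> nonzero_vecs C"
    using g by (auto simp: circuits_def)
  moreover have "x \<in> vecs C"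
    using gnz hnz by (auto simp: x_def vecs_def nonzero_vecs_def)
  ultimately have "x = (\<lambda>_. 0)"
    by (auto simp: nonzero_vecs_def)
  then have "a * g j - b * h j = 0" for j
    unfolding x_def by metis
  then have "h j = (a / b) * g j" for j
    using b0 by (simp add: field_simps)
  then show ?thesis using a0 b0 by (intro exI[of _ "a / b"]) auto
qed

text \<open>
  Proportional circuits have the same ratios, so a ratio is determined by an image support and two
  columns.
\<close>

lemma finite_circuit_ratios:
  assumes "finite R" "finite C"
    and inj: "\<And>x. x \<in> nonzero_vecs C \<Longrightarrow> supp R (mult_vec C B x) \<noteq> {}"
  shows "finite (circuit_ratios R C B)"
proof -
  \<comment> \<open>one circuit for each possible image support\<close>
  define rep where
    "rep S = (SOME g. g \<in> circuits R C B \<and> supp R (mult_vec C B g) = S)" for S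
  define ratio where "ratio = (\<lambda>(S, i, j). \<bar>rep S i / rep S j\<bar>)"
  have "circuit_ratios R C B \<subseteq> ratio ` (Pow R \<times> C \<times> C)"
  proof
    fix y assume "y \<in> circuit_ratios R C B"
    then obtain g i j where y: "y = \<bar>g i / g j\<bar>" and g: "g \<in> circuits R C B"
      and ij: "i \<in> C" "j \<in> C"
      by (auto simp: circuit_ratios_def)
    define S where "S = supp R (mult_vec C B g)"
    have "rep S \<in> circuits R C B \<and> supp R (mult_vec C B (rep S)) = S"
      unfolding rep_def by (rule someI[of _ g]) (use g S_def in auto)
    then obtain c where "c \<noteq> 0" "\<forall>j. rep S j = c * g j"
      using circuits_same_support_proportional[OF g _ _ inj] S_def by metis
    then have "y = ratio (S, i, j)"
      by (simp add: y ratio_def abs_mult)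
    moreover have "S \<in> Pow R" by (auto simp: S_def supp_def)
    ultimately show "y \<in> ratio ` (Pow R \<times> C \<times> C)" using ij by blast
  qed
  then show ?thesis
    by (rule finite_subset) (use assms in auto)
qed

lemma mult_vec_stacked_Inl:
  "finite E \<Longrightarrow> H \<subseteq> E \<Longrightarrow> mult_vec E stacked_matrix x (Inl H) = (\<Sum>e\<in>H. x e)"
  by (auto simp: mult_vec_def stacked_matrix_def indicator_def Int_absorb1 if_distrib
      sum.If_cases cong: if_cong)

lemma mult_vec_stacked_Inr:
  "finite E \<Longrightarrow> d \<in> E \<Longrightarrow> mult_vec E stacked_matrix x (Inr d) = x d"
  by (simp add: mult_vec_def stacked_matrix_def if_distrib[of "\<lambda>z. z * _"]
      cong: if_cong)

text \<open>
  Because of the identity block no nonzero vector has image zero.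
\<close>

lemma supp_stacked_nonempty:
  assumes "finite E" "x \<in> nonzero_vecs E"
  shows "supp (F <+> E) (mult_vec E stacked_matrix x) \<noteq> {}"
proof -
  obtain e where "e \<in> E" "x e \<noteq> 0"
    using assms(2) by (auto simp: nonzero_vecs_def vecs_def fun_eq_iff)
  then have "Inr e \<in> supp (F <+> E) (mult_vec E stacked_matrix x)"
    using assms(1) by (simp add: supp_def mult_vec_stacked_Inr InrI)
  then show ?thesis by blast
qed

lemma circuit_ratio_le_imbalance:
  assumes "finite E" "F \<subseteq> Pow E" "g \<in> circuits (F <+> E) E stacked_matrix"
    "i \<in> E" "j \<in> E" "g j \<noteq> 0"
  shows "\<bar>g i / g j\<bar> \<le> circuit_imbalance (F <+> E) E stacked_matrix"
proof -
  have "finite (circuit_ratios (F <+> E) E stacked_matrix)"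
    using assms(1,2) finite_subset[OF assms(2)]
    by (intro finite_circuit_ratios supp_stacked_nonempty) auto
  moreover have "\<bar>g i / g j\<bar> \<in> circuit_ratios (F <+> E) E stacked_matrix"
    using assms by (auto simp: circuit_ratios_def)
  ultimately show ?thesis
    unfolding circuit_imbalance_def circuit_ratios_def[symmetric] by (rule Max_ge)
qed

section \<open>Only finitely many imbalances for a given number of edges\<close>

definition pullback :: "'c set \<Rightarrow> ('c \<Rightarrow> 'd) \<Rightarrow> ('d \<Rightarrow> real) \<Rightarrow> 'c \<Rightarrow> real" where
  "pullback C \<phi> x = (\<lambda>c. if c \<in> C then x (\<phi> c) else 0)"

lemma pullback_nonzero_vecs:
  assumes \<phi>: "bij_betw \<phi> C' C" and x: "x \<in> nonzero_vecs C"
  shows "pullback C' \<phi> x \<in> nonzero_vecs C'"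
proof -
  obtain c where "c \<in> C" "x c \<noteq> 0"
    using x by (auto simp: nonzero_vecs_def vecs_def fun_eq_iff)
  then obtain c' where "c' \<in> C'" "x (\<phi> c') \<noteq> 0"
    using \<phi> by (auto simp: bij_betw_def)
  then have "pullback C' \<phi> x c' \<noteq> 0" by (simp add: pullback_def)
  then have "pullback C' \<phi> x \<noteq> (\<lambda>_. 0)" by auto
  then show ?thesis by (simp add: nonzero_vecs_def vecs_def pullback_def)
qed

text \<open>
  Renaming the columns by \<open>\<phi>\<close> and the rows by \<open>\<rho>\<close> turns \<open>B\<close> into \<open>B'\<close>; image supports correspond
  under \<open>\<rho>\<close>, and with them the circuits and their ratios.
\<close>

lemma supp_pullback:
  assumes \<phi>: "bij_betw \<phi> C' C" and \<rho>: "bij_betw \<rho> R' R"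
    and B: "\<And>r c. r \<in> R' \<Longrightarrow> c \<in> C' \<Longrightarrow> B (\<rho> r) (\<phi> c) = B' r c"
  shows "supp R (mult_vec C B x) = \<rho> ` supp R' (mult_vec C' B' (pullback C' \<phi> x))"
proof -
  have "mult_vec C B x (\<rho> r) = mult_vec C' B' (pullback C' \<phi> x) r" if "r \<in> R'" for r
    unfolding mult_vec_def
    by (subst sum.reindex_bij_betw[OF \<phi>, symmetric])
      (auto intro!: sum.cong simp: pullback_def B that)
  moreover have "R = \<rho> ` R'" using \<rho> by (simp add: bij_betw_def)
  ultimately show ?thesis by (auto simp: supp_def)
qed

lemma pullback_circuits:
  assumes \<phi>: "bij_betw \<phi> C' C" and \<rho>: "bij_betw \<rho> R' R"
    and B: "\<And>r c. r \<in> R' \<Longrightarrow> c \<in> C' \<Longrightarrow> B (\<rho> r) (\<phi> c) = B' r c"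
    and g: "g \<in> circuits R C B"
  shows "pullback C' \<phi> g \<in> circuits R' C' B'"
proof -
  have "pullback C' \<phi> g \<in> nonzero_vecs C'"
    using g pullback_nonzero_vecs[OF \<phi>] by (simp add: circuits_def)
  moreover have "coprime_integral C' (pullback C' \<phi> g)"
  proof -
    obtain z where z: "\<forall>j\<in>C. g j = of_int (z j)" "Gcd (z ` C) = 1"
      using g by (auto simp: circuits_def coprime_integral_def)
    have im: "\<phi> ` C' = C" using \<phi> by (simp add: bij_betw_def)
    then have "(z \<circ> \<phi>) ` C' = z ` C" by (metis image_comp)
    then show ?thesis
      using z im unfolding coprime_integral_def
      by (intro exI[of _ "z \<circ> \<phi>"]) (auto simp: pullback_def)
  qed
  moreover have "\<not> supp R' (mult_vec C' B' x) \<subset> supp R' (mult_vec C' B' (pullback C' \<phi> g))"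
    if x: "x \<in> nonzero_vecs C'" for x
  proof
    assume less: "supp R' (mult_vec C' B' x) \<subset> supp R' (mult_vec C' B' (pullback C' \<phi> g))"
    define \<psi> where "\<psi> = inv_into C' \<phi>"
    have \<psi>: "bij_betw \<psi> C C'" unfolding \<psi>_def by (rule bij_betw_inv_into[OF \<phi>])
    \<comment> \<open>a vector that contradicts minimality of the pullback is carried back to one that contradicts
      minimality of \<open>g\<close>\<close>
    define y where "y = pullback C \<psi> x"
    have "\<psi> (\<phi> c) = c" "\<phi> c \<in> C" if "c \<in> C'" for c
      using \<phi> that by (auto simp: \<psi>_def bij_betw_def)
    then have "pullback C' \<phi> y = x"
      using x by (auto simp: y_def pullback_def nonzero_vecs_def vecs_def)
    then have "supp R (mult_vec C B y) = \<rho> ` supp R' (mult_vec C' B' x)"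
      using supp_pullback[where B = B and B' = B', OF \<phi> \<rho> B] by simp
    also have "\<dots> \<subset> \<rho> ` supp R' (mult_vec C' B' (pullback C' \<phi> g))"
      using \<rho> less by (intro image_strict_mono) (auto simp: bij_betw_def inj_on_def supp_def)
    also have "\<dots> = supp R (mult_vec C B g)"
      using supp_pullback[where B = B and B' = B', OF \<phi> \<rho> B] by simp
    finally have "supp R (mult_vec C B y) \<subset> supp R (mult_vec C B g)" .
    moreover have "y \<in> nonzero_vecs C"
      unfolding y_def by (rule pullback_nonzero_vecs[OF \<psi> x])
    ultimately show False using g by (auto simp: circuits_def)
  qed
  ultimately show ?thesis by (auto simp: circuits_def)
qed

lemma circuit_ratios_transport_subset:
  assumes \<phi>: "bij_betw \<phi> C' C" and \<rho>: "bij_betw \<rho> R' R"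
    and B: "\<And>r c. r \<in> R' \<Longrightarrow> c \<in> C' \<Longrightarrow> B (\<rho> r) (\<phi> c) = B' r c"
  shows "circuit_ratios R C B \<subseteq> circuit_ratios R' C' B'"
proof
  fix y assume "y \<in> circuit_ratios R C B"
  then obtain g i j where y: "y = \<bar>g i / g j\<bar>" and g: "g \<in> circuits R C B"
    and ij: "i \<in> C" "j \<in> C" "g j \<noteq> 0"
    by (auto simp: circuit_ratios_def)
  obtain i' j' where ij': "i' \<in> C'" "i = \<phi> i'" "j' \<in> C'" "j = \<phi> j'"
    using ij \<phi> by (auto simp: bij_betw_def)
  show "y \<in> circuit_ratios R' C' B'"
    unfolding circuit_ratios_def mem_Collect_eq
    using pullback_circuits[where B = B and B' = B', OF \<phi> \<rho> B g] ij ij' y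
    by (intro exI[of _ "pullback C' \<phi> g"] exI[of _ i'] exI[of _ j']) (auto simp: pullback_def)
qed

lemma circuit_imbalance_transport:
  assumes \<phi>: "bij_betw \<phi> C' C" and \<rho>: "bij_betw \<rho> R' R"
    and B: "\<And>r c. r \<in> R' \<Longrightarrow> c \<in> C' \<Longrightarrow> B (\<rho> r) (\<phi> c) = B' r c"
  shows "circuit_imbalance R C B = circuit_imbalance R' C' B'"
proof -
  have "B' (inv_into R' \<rho> r) (inv_into C' \<phi> c) = B r c" if "r \<in> R" "c \<in> C" for r c
    using that B[of "inv_into R' \<rho> r" "inv_into C' \<phi> c"] \<phi> \<rho>
    by (metis bij_betw_def f_inv_into_f inv_into_into)
  then have "circuit_ratios R' C' B' \<subseteq> circuit_ratios R C B"
    using bij_betw_inv_into[OF \<phi>] bij_betw_inv_into[OF \<rho>]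
    by (intro circuit_ratios_transport_subset)
  moreover have "circuit_ratios R C B \<subseteq> circuit_ratios R' C' B'"
    using \<phi> \<rho> B by (rule circuit_ratios_transport_subset)
  ultimately show ?thesis
    unfolding circuit_imbalance_def circuit_ratios_def[symmetric] by simp
qed

lemma stacked_imbalance_relabel:
  assumes \<phi>: "bij_betw \<phi> C E" and F: "F \<subseteq> Pow E"
  shows "circuit_imbalance (F <+> E) E stacked_matrix =
    circuit_imbalance ({S \<in> Pow C. \<phi> ` S \<in> F} <+> C) C stacked_matrix"
proof (rule circuit_imbalance_transport[OF \<phi>])
  let ?F' = "{S \<in> Pow C. \<phi> ` S \<in> F}"
  have inj: "inj_on \<phi> C" and im: "\<phi> ` C = E" using \<phi> by (auto simp: bij_betw_def)
  have bij: "bij_betw (image \<phi>) ?F' F"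
  proof (rule bij_betw_imageI)
    show "inj_on (image \<phi>) ?F'"
      by (rule inj_on_subset[OF inj_on_image_Pow[OF inj]]) auto
    have "S \<in> image \<phi> ` ?F'" if "S \<in> F" for S
    proof -
      have "S \<subseteq> \<phi> ` C" using that F im by auto
      then obtain T where "T \<subseteq> C" "S = \<phi> ` T" by (auto simp: subset_image_iff)
      then show ?thesis using that by auto
    qed
    then show "image \<phi> ` ?F' = F" by auto
  qed
  show "bij_betw (map_sum (image \<phi>) \<phi>) (?F' <+> C) (F <+> E)"
  proof (rule bij_betw_imageI)
    show "inj_on (map_sum (image \<phi>) \<phi>) (?F' <+> C)"
    proof (rule inj_onI)
      fix r q assume "r \<in> ?F' <+> C" "q \<in> ?F' <+> C"
        "map_sum (image \<phi>) \<phi> r = map_sum (image \<phi>) \<phi> q"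
      then show "r = q"
        using inj_onD[OF inj] inj_onD[OF bij_betw_imp_inj_on[OF bij]]
        by (cases r; cases q) (simp_all add: Plus_def image_iff)
    qed
    have "map_sum (image \<phi>) \<phi> ` (?F' <+> C) = (image \<phi> ` ?F') <+> (\<phi> ` C)"
      by (auto simp: Plus_def image_Un image_image)
    then show "map_sum (image \<phi>) \<phi> ` (?F' <+> C) = F <+> E"
      using bij im by (simp add: bij_betw_def)
  qed
  fix r c assume r: "r \<in> ?F' <+> C" and c: "c \<in> C"
  show "stacked_matrix (map_sum (image \<phi>) \<phi> r) (\<phi> c) = stacked_matrix r c"
    using r c inj
    by (auto simp: stacked_matrix_def indicator_def inj_on_image_mem_iff inj_on_eq_iff)
qed

lemma simple_graph_finite_edges: "simple_graph G \<Longrightarrow> finite (snd G)"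
  unfolding simple_graph_def by (rule finite_subset[of _ "Pow (fst G)"]) auto

lemma finite_graph_imbalances:
  fixes \<H> :: "'v graph \<Rightarrow> 'v set set set"
  assumes "\<And>G. simple_graph G \<Longrightarrow> \<H> G \<subseteq> Pow (snd G)"
  shows "finite {graph_imbalance G (\<H> G) | G. simple_graph G \<and> card (snd G) = m}"
proof (rule finite_subset)
  let ?f = "\<lambda>F. circuit_imbalance (F <+> {..<m}) {..<m} stacked_matrix"
  show "{graph_imbalance G (\<H> G) | G. simple_graph G \<and> card (snd G) = m} \<subseteq> ?f ` Pow (Pow {..<m})"
  proof clarify
    fix G :: "'v graph" assume G: "simple_graph G" and m: "m = card (snd G)"
    obtain \<phi> where "bij_betw \<phi> {..<m} (snd G)"
      using ex_bij_betw_nat_finite[OF simple_graph_finite_edges[OF G]] m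
      by (auto simp: atLeast0LessThan)
    from stacked_imbalance_relabel[OF this assms[OF G]]
    have "graph_imbalance G (\<H> G) = ?f {S \<in> Pow {..<m}. \<phi> ` S \<in> \<H> G}"
      by (simp add: graph_imbalance_def)
    then show "graph_imbalance G (\<H> G) \<in> (\<lambda>F. circuit_imbalance (F <+> {..<card (snd G)})
      {..<card (snd G)} stacked_matrix) ` Pow (Pow {..<card (snd G)})"
      unfolding m by blast
  qed
qed simp

section \<open>Vectors determined by their zero-sum subsets\<close>

text \<open>
  The subsets over which \<open>g\<close> sums to zero are the rows, among all 0/1 rows, that vanish on \<open>g\<close>;
  rigidity says that their common kernel is the line spanned by \<open>g\<close>.
\<close>

definition zero_sum_rigid :: "'e set \<Rightarrow> ('e \<Rightarrow> int) \<Rightarrow> bool" where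
  "zero_sum_rigid E g \<longleftrightarrow> (\<forall>x :: 'e \<Rightarrow> real.
     (\<forall>S\<subseteq>E. (\<Sum>e\<in>S. g e) = 0 \<longrightarrow> (\<Sum>e\<in>S. x e) = 0) \<longrightarrow> (\<exists>t :: real. \<forall>e\<in>E. x e = t * g e))"

lemma zero_sum_rigidE:
  assumes "zero_sum_rigid E g" and "\<And>S. S \<subseteq> E \<Longrightarrow> (\<Sum>e\<in>S. g e) = 0 \<Longrightarrow> (\<Sum>e\<in>S. x e :: real) = 0"
  obtains t :: real where "\<And>e. e \<in> E \<Longrightarrow> x e = t * g e"
proof -
  have "\<exists>t :: real. \<forall>e\<in>E. x e = t * g e"
    using assms(1)[unfolded zero_sum_rigid_def, THEN spec, of x] assms(2) by simp
  then show thesis using that by auto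
qed

text \<open>
  If the image of \<open>x\<close> has smaller support than that of \<open>g\<close>, then \<open>x\<close> satisfies all zero-sum
  equations of \<open>g\<close>, so it is a multiple of \<open>g\<close> and its image has the same support. An entry \<open>1\<close>
  makes \<open>g\<close> coprime.
\<close>

lemma zero_sum_rigid_circuit:
  assumes fin: "finite E" and F: "F \<subseteq> Pow E" "\<And>S. S \<subseteq> E \<Longrightarrow> card S \<ge> 2 \<Longrightarrow> S \<in> F"
    and rigid: "zero_sum_rigid E g" and unit: "e0 \<in> E" "g e0 = 1"
  shows "(\<lambda>e. if e \<in> E then of_int (g e) else 0) \<in> circuits (F <+> E) E stacked_matrix"
    (is "?g \<in> _")
proof -
  have "?g \<in> nonzero_vecs E"
    using unit by (auto simp: nonzero_vecs_def vecs_def fun_eq_iff intro!: exI[of _ e0])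
  moreover have "coprime_integral E ?g"
    unfolding coprime_integral_def using unit
    by (intro exI[of _ g]) (auto intro!: Gcd_eq_1_I[of 1] rev_image_eqI[of e0])
  moreover have "\<not> supp (F <+> E) (mult_vec E stacked_matrix x)
      \<subset> supp (F <+> E) (mult_vec E stacked_matrix ?g)" if x: "x \<in> nonzero_vecs E" for x
  proof
    let ?supp = "\<lambda>y. supp (F <+> E) (mult_vec E stacked_matrix y)"
    assume less: "?supp x \<subset> ?supp ?g"
    have "(\<Sum>e\<in>S. x e) = 0" if S: "S \<subseteq> E" "(\<Sum>e\<in>S. g e) = 0" for S
    proof -
      have finS: "finite S" using S(1) fin finite_subset by blast
      have "(\<Sum>e\<in>S. ?g e) = of_int (\<Sum>e\<in>S. g e)"
        using S(1) by (auto simp: subset_iff intro!: sum.cong)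
      then have gS: "(\<Sum>e\<in>S. ?g e) = 0" using S(2) by simp
      consider "S = {}" | e where "S = {e}" | "card S \<ge> 2"
        using finS by (metis One_nat_def Suc_1 card_0_eq card_1_singletonE
            le_less_Suc_eq not_less_eq_eq less_Suc0 not_less)
      then show ?thesis
      proof cases
        case 1
        then show ?thesis by simp
      next
        case 2
        then have "Inr e \<notin> ?supp ?g"
          using gS S(1) fin by (simp add: supp_def mult_vec_stacked_Inr)
        then have "Inr e \<notin> ?supp x" using less by blast
        then show ?thesis
          using 2 S(1) fin by (simp add: supp_def mult_vec_stacked_Inr InrI)
      next
        case 3
        then have "S \<in> F" using F(2) S(1) by blast
        have "Inl S \<notin> ?supp ?g"
          using gS S(1) fin by (simp add: supp_def mult_vec_stacked_Inl)
        then have "Inl S \<notin> ?supp x" using less by blast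
        then show ?thesis
          using \<open>S \<in> F\<close> S(1) fin by (simp add: supp_def mult_vec_stacked_Inl InlI)
      qed
    qed
    then obtain t :: real where t: "\<And>e. e \<in> E \<Longrightarrow> x e = t * g e"
      using zero_sum_rigidE[OF rigid] by metis
    have xt: "x = (\<lambda>e. t * ?g e)"
      using t x by (auto simp: nonzero_vecs_def vecs_def fun_eq_iff)
    have t0: "t \<noteq> 0" using x xt by (auto simp: nonzero_vecs_def)
    have "mult_vec E stacked_matrix x r = t * mult_vec E stacked_matrix ?g r" for r
      unfolding xt mult_vec_def sum_distrib_left by (intro sum.cong) auto
    then have "?supp x = ?supp ?g" using t0 by (simp add: supp_def)
    then show False using less by blast
  qed
  ultimately show ?thesis by (auto simp: circuits_def)
qed

text \<open>
  An amplifier is the local condition under which new columns \<open>N\<close> can be attached to a rigid vector.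
  It is rigidity of \<open>h\<close> together with one extra entry \<open>1\<close>, where \<open>s\<close> is the value of \<open>x\<close> at the extra
  entry: subsets of \<open>N\<close> with sum \<open>-1\<close> become zero-sum once the extra entry is added. In the application
  a subset sum of old columns takes the place of the extra entry.
\<close>

definition amplifier :: "'e set \<Rightarrow> ('e \<Rightarrow> int) \<Rightarrow> bool" where
  "amplifier N h \<longleftrightarrow> (\<forall>(x :: 'e \<Rightarrow> real) (s :: real).
     (\<forall>S\<subseteq>N. (\<Sum>e\<in>S. h e) = 0 \<longrightarrow> (\<Sum>e\<in>S. x e) = 0) \<longrightarrow>
     (\<forall>S\<subseteq>N. (\<Sum>e\<in>S. h e) = - 1 \<longrightarrow> (\<Sum>e\<in>S. x e) = - s) \<longrightarrow>
     (\<forall>e\<in>N. x e = s * h e))"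

text \<open>
  A subset of \<open>N\<close> with \<open>h\<close>-sum \<open>-1\<close> has sum \<open>-q\<close> in the extended vector and hence cancels against \<open>Q\<close>.
  So the zero-sum equations contain the equations of the amplifier with \<open>s\<close> equal to the sum of \<open>x\<close>
  over \<open>Q\<close>, which is \<open>t * q\<close> by rigidity on \<open>E\<close>.
\<close>

lemma zero_sum_rigid_extend:
  assumes fin: "finite E" "finite N" and disj: "E \<inter> N = {}"
    and rigid: "zero_sum_rigid E g" and amp: "amplifier N h"
    and Q: "Q \<subseteq> E" "(\<Sum>e\<in>Q. g e) = q"
  shows "zero_sum_rigid (E \<union> N) (\<lambda>e. if e \<in> E then g e else q * h e)" (is "zero_sum_rigid _ ?g")
  unfolding zero_sum_rigid_def
proof (intro allI impI)
  fix x :: "'a \<Rightarrow> real"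
  assume x: "\<forall>S\<subseteq>E \<union> N. (\<Sum>e\<in>S. ?g e) = 0 \<longrightarrow> (\<Sum>e\<in>S. x e) = 0"
  have gE: "(\<Sum>e\<in>S. ?g e) = (\<Sum>e\<in>S. g e)" if "S \<subseteq> E" for S
    using that by (intro sum.cong) auto
  have gN: "(\<Sum>e\<in>S. ?g e) = q * (\<Sum>e\<in>S. h e)" if "S \<subseteq> N" for S
    unfolding sum_distrib_left using that disj by (intro sum.cong) auto
  have "(\<Sum>e\<in>S. x e) = 0" if "S \<subseteq> E" "(\<Sum>e\<in>S. g e) = 0" for S
    using x gE[OF that(1)] that by (simp add: le_supI1)
  then obtain t :: real where t: "\<And>e. e \<in> E \<Longrightarrow> x e = t * g e"
    using zero_sum_rigidE[OF rigid] by metis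
  have xQ: "(\<Sum>e\<in>Q. x e) = t * q"
    unfolding Q(2)[symmetric] of_int_sum sum_distrib_left using t Q(1) by (intro sum.cong) auto
  have "\<forall>S\<subseteq>N. (\<Sum>e\<in>S. h e) = 0 \<longrightarrow> (\<Sum>e\<in>S. x e) = 0"
    using x gN by (metis le_supI2 mult_zero_right)
  moreover have "\<forall>S\<subseteq>N. (\<Sum>e\<in>S. h e) = - 1 \<longrightarrow> (\<Sum>e\<in>S. x e) = - (t * q)"
  proof (intro allI impI)
    fix S assume S: "S \<subseteq> N" "(\<Sum>e\<in>S. h e) = - 1"
    have un: "sum f (Q \<union> S) = sum f Q + sum f S" for f :: "'a \<Rightarrow> 'b::comm_monoid_add"
      using Q(1) S(1) disj fin by (intro sum.union_disjoint) (auto intro: finite_subset)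
    have "(\<Sum>e\<in>Q \<union> S. ?g e) = 0"
      using un[of ?g] gE[OF Q(1)] gN[OF S(1)] Q(2) S(2) by simp
    then have "(\<Sum>e\<in>Q \<union> S. x e) = 0"
      using x Q(1) S(1) by (metis Un_mono)
    then show "(\<Sum>e\<in>S. x e) = - (t * q)"
      using un[of x] xQ by simp
  qed
  ultimately have "\<forall>e\<in>N. x e = t * q * h e"
    using amp[unfolded amplifier_def, THEN spec, THEN spec, of x "t * q"] by simp
  then have "\<forall>e\<in>E \<union> N. x e = t * ?g e"
    using t disj by auto
  then show "\<exists>t :: real. \<forall>e\<in>E \<union> N. x e = t * ?g e" by blast
qed

lemma amplifier_singleton: "h e \<in> {0, - 1} \<Longrightarrow> amplifier {e} h"
  by (auto simp: amplifier_def dest: spec[of _ "{e}"])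

section \<open>Twelve columns that amplify by 6378\<close>

text \<open>
  The numbers below \<open>13\<close> stand for \<open>\<int>/13\<close>. Row \<open>i\<close> of the circulant matrix is the indicator of
  \<open>translate i\<close>, the residues \<open>j\<close> with \<open>i - j\<close> in the base set. The base set was found by a
  search among \<open>12\<times>12\<close> Toeplitz 0/1 matrices of determinant \<open>\<plusminus>1\<close> for one whose inverse has a large sum
  over a block of entries; the best ones turned out to extend to circulant matrices of order \<open>13\<close>.
\<close>

definition base_set :: "nat set" where
  "base_set = {0, 3, 5, 6, 7, 8, 12}"

definition translate :: "nat \<Rightarrow> nat set" where
  "translate i = {j \<in> {..<13}. (i + 13 - j) mod 13 \<in> base_set}"

text \<open>
  Up to the factor \<open>-6377\<close> this is the last column of the inverse of the circulant matrix, as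
  \<open>weights_translate\<close> shows. Position \<open>12\<close>, with entry \<open>1\<close>, is the place where blocks are glued; the other
  twelve positions are the new columns of a block.
\<close>

definition weights :: "int list" where
  "weights = [-846, 1492, 414, 491, -881, -783, -790, -1245, 1065, -1833, 1107, 897, 1]"

lemma sum_translate:
  fixes f :: "nat \<Rightarrow> 'a::semiring_1"
  shows "(\<Sum>j\<in>translate i. f j) = (\<Sum>j<13. of_bool (j \<in> translate i) * f j)"
proof -
  have "translate i = {j \<in> {..<13}. j \<in> translate i}" by (auto simp: translate_def)
  then have "(\<Sum>j\<in>translate i. f j) = (\<Sum>j<13. if j \<in> translate i then f j else 0)"
    using sum.inter_filter[of "{..<13}" f "\<lambda>j. j \<in> translate i"] by simp
  also have "\<dots> = (\<Sum>j<13. of_bool (j \<in> translate i) * f j)"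
    by (intro sum.cong) auto
  finally show ?thesis .
qed

lemma in_translate: "j < 13 \<Longrightarrow> j \<in> translate i \<longleftrightarrow> (i + 13 - j) mod 13 \<in> base_set"
  by (simp add: translate_def)

lemma weights_translate:
  assumes "i < 13"
  shows "(\<Sum>j\<in>translate i. weights ! j) = (if i = 12 then - 6377 else 0)"
proof -
  have "\<forall>i\<in>{..<13}. (\<Sum>j<13. of_bool ((i + 13 - j) mod 13 \<in> base_set) * weights ! j) =
      (if i = 12 then - 6377 else 0)"
    unfolding base_set_def weights_def by code_simp
  moreover have "(\<Sum>j\<in>translate i. weights ! j) =
      (\<Sum>j<13. of_bool ((i + 13 - j) mod 13 \<in> base_set) * weights ! j)"
    unfolding sum_translate by (intro sum.cong) (auto simp: in_translate)
  ultimately show ?thesis using assms by simp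
qed

text \<open>
  Cyclic shifts of the weights are the columns of the inverse matrix, up to the factor \<open>-6377\<close>. The
  constant \<open>25 = 12 + 13\<close> shifts position \<open>12\<close> of the weights to the diagonal and keeps the subtraction
  nonnegative.
\<close>

lemma weights_inverse:
  assumes "k < 13" "j < 13"
  shows "(\<Sum>i<13. weights ! ((k + 25 - i) mod 13) * of_bool (j \<in> translate i)) =
    (if k = j then - 6377 else 0)"
proof -
  have "\<forall>k\<in>{..<13}. \<forall>j\<in>{..<13}.
      (\<Sum>i<13. weights ! ((k + 25 - i) mod 13) * of_bool ((i + 13 - j) mod 13 \<in> base_set)) =
      (if k = j then - 6377 else 0)"
    unfolding base_set_def weights_def by code_simp
  then show ?thesis using assms by (simp add: in_translate)
qed

text \<open>
  The first twelve equations say that the matrix maps \<open>y\<close> to \<open>\<delta>\<close> times the last unit vector. Applying the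
  inverse matrix gives \<open>-6377 * y k = \<delta> * weights ! k\<close>, and the instance \<open>k = 12\<close> eliminates \<open>\<delta>\<close>.
\<close>

lemma translate_sums_kernel:
  fixes y :: "nat \<Rightarrow> real"
  assumes zero: "\<And>i. i < 12 \<Longrightarrow> (\<Sum>j\<in>translate i. y j) = 0" and k: "k < 13"
  shows "y k = y 12 * weights ! k"
proof -
  define \<delta> where "\<delta> = (\<Sum>j\<in>translate 12. y j)"
  have main: "- 6377 * y k = \<delta> * weights ! k" if k: "k < 13" for k
  proof -
    let ?w = "\<lambda>i. real_of_int (weights ! ((k + 25 - i) mod 13))"
    have inv: "(\<Sum>i<13. ?w i * of_bool (j \<in> translate i)) = (if k = j then - 6377 else 0)"
      if "j < 13" for j
      using arg_cong[OF weights_inverse[OF k that], of real_of_int]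
      by (simp add: if_distrib[of real_of_int] cong: if_cong)
    have "(\<Sum>i<13. ?w i * (\<Sum>j\<in>translate i. y j)) =
        (\<Sum>i<13. \<Sum>j<13. ?w i * of_bool (j \<in> translate i) * y j)"
      unfolding sum_translate sum_distrib_left by (simp only: mult.assoc)
    also have "\<dots> = (\<Sum>j<13. (\<Sum>i<13. ?w i * of_bool (j \<in> translate i)) * y j)"
      unfolding sum_distrib_right by (rule sum.swap)
    also have "\<dots> = (\<Sum>j<13. if k = j then - 6377 * y j else 0)"
    proof (intro sum.cong refl)
      fix j :: nat assume "j \<in> {..<13}"
      then show "(\<Sum>i<13. ?w i * of_bool (j \<in> translate i)) * y j = (if k = j then - 6377 * y j else 0)"
        by (subst inv) auto
    qed
    also have "\<dots> = - 6377 * y k" using k by simp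
    finally have "- 6377 * y k = (\<Sum>i<13. ?w i * (\<Sum>j\<in>translate i. y j))" ..
    also have "\<dots> = (\<Sum>i<(13::nat). if i = 12 then \<delta> * weights ! k else 0)"
      using k by (intro sum.cong) (auto simp: zero \<delta>_def)
    finally show ?thesis by simp
  qed
  have "\<delta> = - 6377 * y 12" using main[of 12] by (simp add: weights_def)
  then show ?thesis using main[OF k] by simp
qed

lemma translate_minus_12: "translate i - {12} \<subseteq> {..<12}"
  by (auto simp: translate_def)

lemma sum_translate_minus_12:
  fixes f :: "nat \<Rightarrow> 'a::ab_group_add"
  shows "(\<Sum>j\<in>translate i - {12}. f j) = (\<Sum>j\<in>translate i. f j) - (if 12 \<in> translate i then f 12 else 0)"
  by (simp add: sum_diff1 translate_def)

text \<open>
  The twelve equations of \<open>translate_sums_kernel\<close>, with \<open>s\<close> at position \<open>12\<close>, are all of the form that the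
  definition of an amplifier provides: removing position \<open>12\<close> from a translate leaves a subset of the block
  with weight \<open>0\<close> or \<open>-1\<close>.
\<close>

lemma amplifier_weights:
  assumes b: "bij_betw b {..<12::nat} N" and h: "\<And>i. i < 12 \<Longrightarrow> h (b i) = weights ! i"
  shows "amplifier N h"
  unfolding amplifier_def
proof (intro allI impI ballI)
  fix x :: "'a \<Rightarrow> real" and s :: real and e
  assume x0: "\<forall>S\<subseteq>N. (\<Sum>e\<in>S. h e) = 0 \<longrightarrow> (\<Sum>e\<in>S. x e) = 0"
    and x1: "\<forall>S\<subseteq>N. (\<Sum>e\<in>S. h e) = - 1 \<longrightarrow> (\<Sum>e\<in>S. x e) = - s"
    and e: "e \<in> N"
  define y where "y j = (if j = 12 then s else x (b j))" for j
  have "(\<Sum>j\<in>translate i. y j) = 0" if i: "i < 12" for i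
  proof -
    define S where "S = translate i - {12}"
    have S: "S \<subseteq> {..<12}" unfolding S_def by (rule translate_minus_12)
    have sub: "b ` S \<subseteq> N"
      using b S by (auto simp: bij_betw_def)
    have "inj_on b S"
      using b S by (auto simp: bij_betw_def intro: inj_on_subset)
    note reindex = sum.reindex[OF this, unfolded o_def]
    have "(\<Sum>e\<in>b ` S. h e) = (\<Sum>j\<in>S. weights ! j)"
      unfolding reindex using S by (intro sum.cong) (auto simp: h)
    also have "\<dots> = (if 12 \<in> translate i then - 1 else 0)"
      using i by (simp add: S_def sum_translate_minus_12 weights_translate) (simp add: weights_def)
    finally have "(\<Sum>e\<in>b ` S. x e) = (if 12 \<in> translate i then - s else 0)"
      using x0 x1 sub by simp
    moreover have "(\<Sum>e\<in>b ` S. x e) = (\<Sum>j\<in>S. y j)"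
      unfolding reindex using S by (intro sum.cong) (auto simp: y_def)
    moreover have "(\<Sum>j\<in>translate i. y j) = (\<Sum>j\<in>S. y j) + (if 12 \<in> translate i then s else 0)"
      unfolding S_def sum_translate_minus_12 by (simp add: y_def[of 12])
    ultimately show ?thesis by (simp split: if_splits)
  qed
  then have y: "y i = s * weights ! i" if "i < 12" for i
    using translate_sums_kernel[of y i] that by (simp add: y_def[of 12])
  obtain i where i: "i < 12" "e = b i" using b e by (auto simp: bij_betw_def)
  then show "x e = s * h e" using y[OF i(1)] h[OF i(1)] by (simp add: y_def)
qed

text \<open>
  The translate by \<open>12\<close> is the only one whose weights do not cancel. Without position \<open>12\<close> they sum to
  \<open>-6377 - 1 = -6378\<close>, so this part of the newest block is the subset \<open>Q\<close> that feeds the next one.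
\<close>

lemma zero_sum_rigid_blocks:
  assumes "card E = 12 * k + 1"
  shows "\<exists>g Q. zero_sum_rigid E g \<and> Q \<subseteq> E \<and> (\<Sum>e\<in>Q. g e) = (- 6378) ^ k \<and> 1 \<in> g ` E"
  using assms
proof (induction k arbitrary: E)
  case 0
  then obtain e where E: "E = {e}" by (auto simp: card_1_singleton_iff)
  have "zero_sum_rigid E (\<lambda>_. 1)" by (auto simp: zero_sum_rigid_def E)
  then show ?case using E by (intro exI[of _ "\<lambda>_. 1"] exI[of _ E]) auto
next
  case (Suc k)
  have fin: "finite E" using Suc.prems by (intro card_ge_0_finite) simp
  obtain E' where E': "E' \<subseteq> E" "card E' = 12 * k + 1"
    using obtain_subset_with_card_n[of "12 * k + 1" E] Suc.prems by auto
  define N where "N = E - E'"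
  have finE': "finite E'" and finN: "finite N" and E: "E = E' \<union> N" and disj: "E' \<inter> N = {}"
    using fin E'(1) finite_subset by (auto simp: N_def)
  have "card N = 12"
    using card_Diff_subset[OF finE' E'(1)] Suc.prems E'(2) by (simp add: N_def)
  then obtain b where b: "bij_betw b {..<12::nat} N"
    using ex_bij_betw_nat_finite[OF finN] by (auto simp: atLeast0LessThan)
  define h where "h e = weights ! inv_into {..<12} b e" for e
  have hb: "h (b i) = weights ! i" if "i < 12" for i
    using b that by (simp add: h_def bij_betw_def)
  obtain g Q where g: "zero_sum_rigid E' g" and Q: "Q \<subseteq> E'" "(\<Sum>e\<in>Q. g e) = (- 6378) ^ k"
    and unit: "1 \<in> g ` E'"
    using Suc.IH[OF E'(2)] by blast
  define g' where "g' = (\<lambda>e. if e \<in> E' then g e else (- 6378) ^ k * h e)"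
  have "zero_sum_rigid E g'"
    unfolding E g'_def
    by (rule zero_sum_rigid_extend[OF finE' finN disj g amplifier_weights[OF b hb] Q])
  moreover have "b ` (translate 12 - {12}) \<subseteq> E"
    using b E translate_minus_12[of 12] by (auto simp: bij_betw_def)
  moreover have "(\<Sum>e\<in>b ` (translate 12 - {12}). g' e) = (- 6378) ^ Suc k"
  proof -
    have inj: "inj_on b (translate 12 - {12})"
      by (rule inj_on_subset[OF bij_betw_imp_inj_on[OF b] translate_minus_12])
    have g'b: "g' (b i) = (- 6378) ^ k * weights ! i" if "i < 12" for i
      using b that disj hb[OF that] by (auto simp: g'_def bij_betw_def)
    have "(\<Sum>e\<in>b ` (translate 12 - {12}). g' e) =
        (- 6378) ^ k * (\<Sum>i\<in>translate 12 - {12}. weights ! i)"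
      unfolding sum.reindex[OF inj] o_def sum_distrib_left
      using translate_minus_12[of 12] by (intro sum.cong) (auto simp: g'b)
    also have "(\<Sum>i\<in>translate 12 - {12}. weights ! i) = - 6378"
      by (simp add: sum_translate_minus_12 weights_translate)
        (simp add: in_translate base_set_def weights_def)
    finally show ?thesis by simp
  qed
  moreover have "1 \<in> g' ` E"
    using unit E by (auto simp: g'_def image_iff)
  ultimately show ?case by blast
qed

text \<open>
  Columns with entry \<open>0\<close> are pinned by their own singletons.
\<close>

lemma zero_sum_rigid_pad:
  assumes fin: "finite E" and E': "E' \<subseteq> E" "zero_sum_rigid E' g"
  shows "zero_sum_rigid E (\<lambda>e. if e \<in> E' then g e else 0)"
proof -
  have "amplifier (E - E') (\<lambda>_. 0)"
    unfolding amplifier_def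
  proof (intro allI impI ballI)
    fix x :: "'a \<Rightarrow> real" and s :: real and e
    assume "\<forall>S\<subseteq>E - E'. (\<Sum>e\<in>S. 0 :: int) = 0 \<longrightarrow> (\<Sum>e\<in>S. x e) = 0" "e \<in> E - E'"
    from spec[OF this(1), of "{e}"] this(2) show "x e = s * real_of_int 0" by simp
  qed
  from zero_sum_rigid_extend[OF _ _ _ E'(2) this, of "{}" 0]
  show ?thesis using fin E'(1) by (simp add: finite_subset Un_absorb1 cong: if_cong)
qed

text \<open>
  Besides the blocks of twelve columns there are the initial entry \<open>1\<close>, a last column \<open>f\<close> whose entry is
  minus the sum over \<open>Q\<close> of the last block, so that the amplification shows up in a single entry, and up
  to eleven columns with entry \<open>0\<close>. This accounts for at most thirteen columns to which no power of
  \<open>6378\<close> corresponds.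
\<close>

lemma zero_sum_rigid_large_ratio:
  assumes card: "card E = m" "m \<ge> 2"
  shows "\<exists>g. zero_sum_rigid E g \<and> (\<exists>i\<in>E. \<exists>j\<in>E. g j = 1 \<and> 2 ^ m / 2 ^ 13 \<le> \<bar>real_of_int (g i)\<bar>)"
proof -
  define k where "k = (m - 2) div 12"
  have m: "12 * k + 2 \<le> m" "m \<le> 12 * k + 13"
    using card(2) unfolding k_def by presburger+
  have fin: "finite E" using card by (intro card_ge_0_finite) simp
  obtain E2 where E2: "E2 \<subseteq> E" "card E2 = 12 * k + 2"
    using obtain_subset_with_card_n[of "12 * k + 2" E] m card(1) by auto
  then obtain f where f: "f \<in> E2" by fastforce
  have finE2: "finite E2" using E2(1) fin finite_subset by blast
  have "card (E2 - {f}) = 12 * k + 1" using E2(2) f finE2 by simp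
  then obtain g Q where g: "zero_sum_rigid (E2 - {f}) g" and Q: "Q \<subseteq> E2 - {f}"
    "(\<Sum>e\<in>Q. g e) = (- 6378) ^ k" and unit: "1 \<in> g ` (E2 - {f})"
    using zero_sum_rigid_blocks by metis
  obtain j where j: "j \<in> E2 - {f}" "g j = 1" using unit by force
  define g2 where "g2 = (\<lambda>e. if e \<in> E2 - {f} then g e else (- 6378) ^ k * - 1)"
  have "zero_sum_rigid ((E2 - {f}) \<union> {f}) g2"
    unfolding g2_def
    by (rule zero_sum_rigid_extend[OF _ _ _ g amplifier_singleton Q]) (use finE2 in auto)
  then have "zero_sum_rigid E2 g2"
    using f by (simp add: insert_absorb)
  from zero_sum_rigid_pad[OF fin E2(1) this]
  have "zero_sum_rigid E (\<lambda>e. if e \<in> E2 then g2 e else 0)" (is "zero_sum_rigid E ?g") .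
  moreover have "?g j = 1" "j \<in> E" using j E2(1) by (auto simp: g2_def)
  moreover have "2 ^ m / 2 ^ 13 \<le> \<bar>real_of_int (?g f)\<bar>"
  proof -
    have "(2::real) ^ m \<le> 2 ^ (12 * k + 13)" using m(2) by (intro power_increasing) auto
    also have "\<dots> = 4096 ^ k * 2 ^ 13" by (simp add: power_add power_mult)
    also have "\<dots> \<le> 6378 ^ k * 2 ^ 13" by (intro mult_right_mono power_mono) auto
    finally show ?thesis using f by (simp add: g2_def power_abs)
  qed
  ultimately show ?thesis using f E2(1) by blast
qed

section \<open>Stars\<close>

lemma star_with_card:
  assumes "infinite (UNIV :: 'v set)"
  shows "\<exists>G :: 'v graph. simple_graph G \<and> card (snd G) = m \<and> star_edge_sets G = Pow (snd G)"
proof -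
  obtain f :: "nat \<Rightarrow> 'v" where f: "inj f"
    using assms infinite_countable_subset by blast
  define E where "E = (\<lambda>i. {f 0, f (Suc i)}) ` {..<m}"
  have "inj_on (\<lambda>i. {f 0, f (Suc i)}) {..<m}"
    using f by (auto simp: inj_on_def doubleton_eq_iff dest: injD)
  then have "card E = m" by (simp add: E_def card_image)
  moreover have "simple_graph (f ` {..m}, E)"
    using f by (auto simp: simple_graph_def E_def card_insert_if inj_eq)
  moreover have "star_edge_sets (f ` {..m}, E) = Pow E"
    by (auto simp: star_edge_sets_def E_def intro!: bexI[of _ 0])
  ultimately show ?thesis by (intro exI[of _ "(f ` {..m}, E)"]) simp
qed

theorem theorem2p4:
  fixes \<H> :: "'v graph \<Rightarrow> 'v set set set"
  assumes "infinite (UNIV :: 'v set)"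
    and "\<And>G. simple_graph G \<Longrightarrow> \<H> G \<subseteq> Pow (snd G)"
    and "\<And>G. simple_graph G \<Longrightarrow> {H \<in> star_edge_sets G. card H \<ge> 2} \<subseteq> \<H> G"
  shows "family_imbalance \<H> \<in> \<Omega>(\<lambda>m. 2 ^ m)"
proof (rule landau_omega.bigI[of "1 / 2 ^ 13"])
  show "\<forall>\<^sub>F m in sequentially. norm (family_imbalance \<H> m) \<ge> 1 / 2 ^ 13 * norm ((2::real) ^ m)"
    using eventually_ge_at_top[of 2]
  proof eventually_elim
    fix m :: nat assume m: "2 \<le> m"
    obtain G :: "'v graph" where G: "simple_graph G" "card (snd G) = m"
      "star_edge_sets G = Pow (snd G)"
      using star_with_card[OF assms(1)] by blast
    note fin = simple_graph_finite_edges[OF G(1)]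
    obtain g i j where g: "zero_sum_rigid (snd G) g" "i \<in> snd G" "j \<in> snd G" "g j = 1"
      "2 ^ m / 2 ^ 13 \<le> \<bar>real_of_int (g i)\<bar>"
      using zero_sum_rigid_large_ratio[OF G(2) m] by blast
    let ?g = "\<lambda>e. if e \<in> snd G then real_of_int (g e) else 0"
    have "?g \<in> circuits (\<H> G <+> snd G) (snd G) stacked_matrix"
      using assms(2,3)[OF G(1)] G(3) g
      by (intro zero_sum_rigid_circuit[of _ _ _ j]) (auto simp: fin)
    then have "\<bar>?g i / ?g j\<bar> \<le> graph_imbalance G (\<H> G)"
      unfolding graph_imbalance_def using assms(2)[OF G(1)] g
      by (intro circuit_ratio_le_imbalance) (auto simp: fin)
    also have "\<dots> \<le> family_imbalance \<H> m"
      unfolding family_imbalance_def using G(1,2)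
      by (intro Max_ge finite_graph_imbalances[OF assms(2)] CollectI exI[of _ G]) simp_all
    finally show "1 / 2 ^ 13 * norm ((2::real) ^ m) \<le> norm (family_imbalance \<H> m)"
      using g by simp
  qed
qed simp

end
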